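(* For every finite graph $G$ there is a ring $R$ that is a direct product of finitely many distinct (pairwise non-isomorphic) finite fields such that $G$ is isomorphic to an induced subgraph of the zero-divisor graph $\Gamma(R)$.
   Context: Rings are finite commutative rings with unity; graphs are finite simple undirected graphs. For a ring $R$, the zero-divisor graph $\Gamma(R)$ has as vertices the non-zero elements $a\in R$ for which there exists $b\neq 0$ in $R$ with $ab=0$; two distinct vertices $a,b$ are adjacent if and only if $ab=0$. *)

theory Defs
  imports "HOL-Algebra.Algebra" "Graph_Theory.Graph_Theory"
begin

text \<open>
  Undirected graphs follow the convention of \<^verbatim>\<open>Graph_Theory\<close>: a finite simple undirected graph
  is a \<^locale>\<open>pair_graph\<close>, i.e. a finite vertex set with a symmetric irreflexive set of ordered
  pairs, each edge being represented by its two orientations.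
\<close>

definition zero_divisor_verts :: "('a, 'm) ring_scheme \<Rightarrow> 'a set" where
  "zero_divisor_verts R =
     {a \<in> carrier R. a \<noteq> \<zero>\<^bsub>R\<^esub> \<and> (\<exists>b \<in> carrier R. b \<noteq> \<zero>\<^bsub>R\<^esub> \<and> a \<otimes>\<^bsub>R\<^esub> b = \<zero>\<^bsub>R\<^esub>)}"

definition zero_divisor_graph :: "('a, 'm) ring_scheme \<Rightarrow> 'a pair_pre_digraph" where
  "zero_divisor_graph R =
     \<lparr> pverts = zero_divisor_verts R,
       parcs = {(a, b). a \<in> zero_divisor_verts R \<and> b \<in> zero_divisor_verts R \<and>
                        a \<noteq> b \<and> a \<otimes>\<^bsub>R\<^esub> b = \<zero>\<^bsub>R\<^esub>} \<rparr>"

lemma pair_graph_zero_divisor_graph: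
  assumes "cring R" "finite (carrier R)"
  shows "pair_graph (zero_divisor_graph R)"
proof -
  interpret cring R by fact
  have V: "finite (zero_divisor_verts R)"
    using assms(2) by (simp add: zero_divisor_verts_def)
  have A: "finite (parcs (zero_divisor_graph R))"
    by (rule finite_subset[of _ "zero_divisor_verts R \<times> zero_divisor_verts R"])
      (use V in \<open>auto simp: zero_divisor_graph_def\<close>)
  have S: "sym (parcs (zero_divisor_graph R))"
    by (auto simp: sym_def zero_divisor_graph_def zero_divisor_verts_def m_comm)
  show ?thesis
  proof
    show "symmetric (with_proj (zero_divisor_graph R))"
      using S by (simp add: symmetric_def arcs_ends_def arc_to_ends_def)
  qed (use V A in \<open>auto simp: zero_divisor_graph_def\<close>)
qed

end

theory Submission
  imports Defs "HOL-Number_Theory.Residues"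
begin

text \<open>
  Multiplication in a product of fields sees only supports: \<open>a b = 0\<close> iff the supports of \<open>a\<close> and
  \<open>b\<close> are disjoint. So take one coordinate for every non-adjacent pair of vertices (including the
  pairs \<open>(v, v)\<close>), and send a vertex to the 0/1-vector supported on the pairs containing it. Two
  distinct vertices then have disjoint supports iff they are adjacent. One further coordinate, at
  which all vectors vanish, makes them all zero divisors. The coordinate fields are prime fields of
  different orders.
\<close>

text \<open>By \<open>RDirProd_list_hom1\<close>, consing is a ring homomorphism from the binary
  product, where multiplication is componentwise by definition.\<close>

lemma RDirProd_list_mult_Cons:
  assumes "x \<in> carrier R" "y \<in> carrier R"
    and "xs \<in> carrier (RDirProd_list Rs)" "ys \<in> carrier (RDirProd_list Rs)"
  shows "(x # xs) \<otimes>\<^bsub>RDirProd_list (R # Rs)\<^esub> (y # ys) =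
    (x \<otimes>\<^bsub>R\<^esub> y) # (xs \<otimes>\<^bsub>RDirProd_list Rs\<^esub> ys)"
  using ring_hom_mult[OF RDirProd_list_hom1[of R Rs], of "(x, xs)" "(y, ys)"] assms
  by (simp add: RDirProd_carrier) (simp add: RDirProd_def DirProd_def monoid.defs)

lemma RDirProd_list_mult_eq_zero_iff:
  assumes "xs \<in> carrier (RDirProd_list Rs)" "ys \<in> carrier (RDirProd_list Rs)"
  shows "xs \<otimes>\<^bsub>RDirProd_list Rs\<^esub> ys = \<zero>\<^bsub>RDirProd_list Rs\<^esub> \<longleftrightarrow>
    (\<forall>i < length Rs. xs ! i \<otimes>\<^bsub>Rs ! i\<^esub> ys ! i = \<zero>\<^bsub>Rs ! i\<^esub>)"
  using assms
proof (induction Rs arbitrary: xs ys)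
  case Nil
  then show ?case
    by (simp add: monoid.defs)
next
  case (Cons R Rs)
  then obtain x xs' y ys' where "xs = x # xs'" "ys = y # ys'"
    "x \<in> carrier R" "y \<in> carrier R"
    "xs' \<in> carrier (RDirProd_list Rs)" "ys' \<in> carrier (RDirProd_list Rs)"
    by (auto simp: RDirProd_list_carrier)
  with Cons.IH show ?case
    by (auto simp: RDirProd_list_zero' RDirProd_list_mult_Cons All_less_Suc2)
qed

lemma nth_zero_RDirProd_list: "i < length Rs \<Longrightarrow> \<zero>\<^bsub>RDirProd_list Rs\<^esub> ! i = \<zero>\<^bsub>Rs ! i\<^esub>"
  by (induction Rs arbitrary: i) (auto simp: RDirProd_list_zero' nth_Cons split: nat.split)

text \<open>The witness for \<open>H\<close> is the image of \<open>G\<close> under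
  \<open>f\<close>; the equivalence in \<open>arcs\<close> makes this image an induced subgraph, not
  merely a subgraph.\<close>

lemma digraph_iso_induced_subgraphI:
  assumes "pair_wf_digraph G" "pair_wf_digraph K"
    and inj: "inj_on f (pverts G)"
    and verts: "f ` pverts G \<subseteq> pverts K"
    and arcs: "\<And>u v. u \<in> pverts G \<Longrightarrow> v \<in> pverts G \<Longrightarrow> (f u, f v) \<in> parcs K \<longleftrightarrow> (u, v) \<in> parcs G"
  shows "\<exists>H. induced_subgraph H (with_proj K) \<and> digraph_iso (with_proj G) H"
proof -
  interpret G: pair_wf_digraph G by fact
  interpret K: pair_wf_digraph K by fact
  \<comment> \<open>Arcs are ordered pairs, so \<open>f\<close> acts on them in both components, and
    tail and head remain the projections.\<close>
  define h where "h = \<lparr>iso_verts = f, iso_arcs = map_prod f f, iso_head = snd, iso_tail = fst\<rparr>"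
  have inj_arcs: "inj_on (map_prod f f) (parcs G)"
    by (rule inj_on_subset[OF map_prod_inj_on[OF inj inj]]) (auto dest: G.in_arcsD1 G.in_arcsD2)
  have h: "pre_digraph.digraph_isomorphism (with_proj G) h"
    unfolding pre_digraph.digraph_isomorphism_def
    using G.wf_digraph inj inj_arcs by (simp add: h_def)
  have img: "map_prod f f ` parcs G = {e \<in> parcs K. fst e \<in> f ` pverts G \<and> snd e \<in> f ` pverts G}"
  proof (intro equalityI subsetI)
    fix e assume "e \<in> map_prod f f ` parcs G"
    then show "e \<in> {e \<in> parcs K. fst e \<in> f ` pverts G \<and> snd e \<in> f ` pverts G}"
      using arcs by (auto dest: G.in_arcsD1 G.in_arcsD2)
  next
    fix e assume "e \<in> {e \<in> parcs K. fst e \<in> f ` pverts G \<and> snd e \<in> f ` pverts G}"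
    then obtain u v where "e = (f u, f v)" "(f u, f v) \<in> parcs K" "u \<in> pverts G" "v \<in> pverts G"
      by (cases e) auto
    with arcs show "e \<in> map_prod f f ` parcs G"
      by force
  qed
  have "induced_subgraph (app_iso h (with_proj G)) (with_proj K)"
    unfolding induced_subgraph_def subgraph_def compatible_def
    using G.wf_digraphI_app_iso[OF h] K.wf_digraph verts img by (auto simp: h_def)
  with h show ?thesis
    unfolding digraph_iso_def by blast
qed

lemma residue_ring_simps:
  "carrier (residue_ring m) = {0..m - 1}" "\<zero>\<^bsub>residue_ring m\<^esub> = 0"
  "x \<otimes>\<^bsub>residue_ring m\<^esub> y = (x * y) mod m"
  by (simp_all add: residue_ring_def)

theorem theorem2p6:
  fixes G :: "'v pair_pre_digraph"
  assumes "pair_graph G"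
  shows "\<exists>(Fs :: int ring list) (R :: int list ring) H.
           Fs \<noteq> [] \<and>
           (\<forall>F \<in> set Fs. field F \<and> finite (carrier F)) \<and>
           (\<forall>i < length Fs. \<forall>j < length Fs. i \<noteq> j \<longrightarrow> \<not> (Fs ! i \<simeq> Fs ! j)) \<and>
           R = RDirProd_list Fs \<and>
           induced_subgraph H (with_proj (zero_divisor_graph R)) \<and>
           digraph_iso (with_proj G) H"
proof -
  interpret pair_graph G by fact
  have "finite (pverts G \<times> pverts G - parcs G)"
    using pair_finite_verts by blast
  \<comment> \<open>Since \<open>G\<close> has no loops, \<open>es\<close> contains every diagonal
    pair \<open>(v, v)\<close>; since arcs are symmetric, it lists both orientations of each
    non-adjacent pair.\<close>
  then obtain es where es: "set es = pverts G \<times> pverts G - parcs G"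
    using finite_list by blast
  \<comment> \<open>Coordinate 0 is the extra one; coordinate \<open>Suc k\<close> belongs to the
    pair \<open>es ! k\<close>. Hence \<open>n\<close> is positive even when \<open>G\<close> has no
    vertices.\<close>
  define n where "n = Suc (length es)"
  define p :: "nat \<Rightarrow> nat" where "p = enumerate {p. Factorial_Ring.prime p}"
  have prime_p: "Factorial_Ring.prime (p i)" for i
    using enumerate_in_set[OF primes_infinite] by (simp add: p_def)
  have p_gt_1: "1 < p i" for i
    using prime_p by (rule prime_gt_1_nat)
  have p_inj: "p i = p j \<longleftrightarrow> i = j" for i j
    using strict_mono_enumerate[OF primes_infinite] by (simp add: p_def strict_mono_eq)
  define Fs where "Fs = map (\<lambda>i. residue_ring (int (p i))) [0..<n]"
  define R where "R = RDirProd_list Fs"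
  have length_Fs: "length Fs = n" and nth_Fs: "i < n \<Longrightarrow> Fs ! i = residue_ring (int (p i))" for i
    by (simp_all add: Fs_def)

  have mult_R: "a \<otimes>\<^bsub>R\<^esub> b = \<zero>\<^bsub>R\<^esub> \<longleftrightarrow> (\<forall>i<n. (a ! i * b ! i) mod int (p i) = 0)"
    if "a \<in> carrier R" "b \<in> carrier R" for a b
    using that
    by (simp add: R_def RDirProd_list_mult_eq_zero_iff length_Fs nth_Fs residue_ring_simps)
  have zero_R: "\<zero>\<^bsub>R\<^esub> ! i = 0" if "i < n" for i
    using that by (simp add: R_def nth_zero_RDirProd_list length_Fs nth_Fs residue_ring_simps)
  \<comment> \<open>Every factor contains 0 and 1 because its modulus exceeds 1.\<close>
  have carrier_RI: "a \<in> carrier R" if "length a = n" "\<And>i. i < n \<Longrightarrow> a ! i \<in> {0, 1}" for a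
    unfolding R_def
  proof (rule RDirProd_list_carrier_memI)
    fix i assume "i < length Fs"
    with that(2)[of i] p_gt_1[of i] show "a ! i \<in> carrier (Fs ! i)"
      by (auto simp: length_Fs nth_Fs residue_ring_simps)
  qed (simp add: that length_Fs)

  define f where "f w = 0 # map (\<lambda>(u, v). of_bool (w = u \<or> w = v) :: int) es" for w
  have length_f: "length (f w) = n" for w
    by (simp add: f_def n_def)
  have f_01: "f w ! i \<in> {0, 1}" if "i < n" for w i
    using that by (auto simp: f_def n_def nth_Cons split: nat.split prod.split)
  have f_carrier: "f w \<in> carrier R" for w
    by (intro carrier_RI length_f f_01)
  have f_supp: "\<exists>i<n. f u ! i = 1 \<and> f v ! i = 1"
    if "u \<in> pverts G" "v \<in> pverts G" "(u, v) \<notin> parcs G" for u v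
  proof -
    have "(u, v) \<in> set es"
      using that es by simp
    then obtain i where "i < length es" "es ! i = (u, v)"
      by (auto simp: in_set_conv_nth)
    then show ?thesis
      by (intro exI[of _ "Suc i"]) (simp add: f_def n_def)
  qed
  have f_disjoint: "f u ! i * f v ! i = 0" if "(u, v) \<in> parcs G" "i < n" for u v i
  proof (cases i)
    case (Suc k)
    then have k: "k < length es"
      using that by (simp add: n_def)
    obtain x y where xy: "es ! k = (x, y)"
      by fastforce
    with k have "(x, y) \<in> set es"
      by (metis nth_mem)
    then have "(x, y) \<notin> parcs G" "(y, x) \<notin> parcs G"
      using es arcs_symmetric by auto
    \<comment> \<open>If both \<open>u\<close> and \<open>v\<close> occurred in
      \<open>(x, y)\<close>, then, being distinct, they would form this pair or its reverse, neither
      of which is an arc.\<close>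
    with that no_loops' have "\<not> ((u = x \<or> u = y) \<and> (v = x \<or> v = y))"
      by blast
    then show ?thesis
      using k xy Suc by (auto simp: f_def)
  qed (simp add: f_def)
  have f_mult: "f u \<otimes>\<^bsub>R\<^esub> f v = \<zero>\<^bsub>R\<^esub> \<longleftrightarrow> (u, v) \<in> parcs G"
    if "u \<in> pverts G" "v \<in> pverts G" for u v
  proof
    assume "f u \<otimes>\<^bsub>R\<^esub> f v = \<zero>\<^bsub>R\<^esub>"
    then have "(f u ! i * f v ! i) mod int (p i) = 0" if "i < n" for i
      using that by (simp add: mult_R f_carrier)
    \<comment> \<open>A common 1 would give the product 1, which is nonzero modulo
      \<open>p i\<close>.\<close>
    then have "\<not> (f u ! i = 1 \<and> f v ! i = 1)" if "i < n" for i
      using that p_gt_1[of i] by fastforce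
    with f_supp that show "(u, v) \<in> parcs G"
      by blast
  next
    assume "(u, v) \<in> parcs G"
    then show "f u \<otimes>\<^bsub>R\<^esub> f v = \<zero>\<^bsub>R\<^esub>"
      by (simp add: mult_R f_carrier f_disjoint)
  qed
  have "f u \<noteq> f v" if "u \<in> pverts G" "v \<in> pverts G" "u \<noteq> v" for u v
  proof
    assume "f u = f v"
    \<comment> \<open>The diagonal coordinate of \<open>u\<close> is 1 in \<open>f u\<close> and 0
      in every other \<open>f v\<close>.\<close>
    have "(u, u) \<in> set es"
      using that es no_loops' by blast
    then obtain i where "i < length es" "es ! i = (u, u)"
      by (auto simp: in_set_conv_nth)
    then have "f u ! Suc i \<noteq> f v ! Suc i"
      using that by (simp add: f_def)
    with \<open>f u = f v\<close> show False
      by simp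
  qed
  then have inj: "inj_on f (pverts G)"
    by (meson inj_onI)

  \<comment> \<open>The common annihilator: \<open>e\<close> is supported on coordinate 0 only,
    exactly where every \<open>f w\<close> has its leading 0.\<close>
  define e where "e = (1::int) # replicate (length es) 0"
  have e: "e \<in> carrier R"
    by (auto intro!: carrier_RI simp: e_def n_def nth_Cons split: nat.split)
  have "e ! 0 = 1" "0 < n"
    by (simp_all add: e_def n_def)
  then have e_nonzero: "e \<noteq> \<zero>\<^bsub>R\<^esub>"
    using zero_R by force
  have f_e: "f w \<otimes>\<^bsub>R\<^esub> e = \<zero>\<^bsub>R\<^esub>" for w
    by (simp add: mult_R f_carrier e) (auto simp: f_def e_def n_def nth_Cons split: nat.split)
  have verts: "f w \<in> zero_divisor_verts R" if w: "w \<in> pverts G" for w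
  proof -
    \<comment> \<open>Applying \<open>f_supp\<close> to the pair \<open>(w, w)\<close> yields a
      coordinate at which \<open>f w\<close> is 1.\<close>
    have "(w, w) \<notin> parcs G"
      using no_loops' by blast
    then have "f w \<noteq> \<zero>\<^bsub>R\<^esub>"
      using f_supp[OF w w] zero_R by force
    then show ?thesis
      unfolding zero_divisor_verts_def
      using f_carrier e e_nonzero f_e by blast
  qed

  have wf: "pair_wf_digraph (zero_divisor_graph R)"
    by unfold_locales (auto simp: zero_divisor_graph_def)
  have "\<exists>H. induced_subgraph H (with_proj (zero_divisor_graph R)) \<and> digraph_iso (with_proj G) H"
  proof (rule digraph_iso_induced_subgraphI[OF pair_wf_digraph wf inj])
    show "f ` pverts G \<subseteq> pverts (zero_divisor_graph R)"
      using verts by (auto simp: zero_divisor_graph_def)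
    show "(f u, f v) \<in> parcs (zero_divisor_graph R) \<longleftrightarrow> (u, v) \<in> parcs G"
      if "u \<in> pverts G" "v \<in> pverts G" for u v
      \<comment> \<open>Injectivity of \<open>f\<close> and the absence of loops in \<open>G\<close>
        account for the distinctness condition on arcs of the zero-divisor graph.\<close>
      using that verts f_mult inj_on_eq_iff[OF inj] no_loops'[of u v]
      by (auto simp: zero_divisor_graph_def)
  qed
  moreover have "field F \<and> finite (carrier F)" if F_in: "F \<in> set Fs" for F
  proof -
    obtain i where F: "F = residue_ring (int (p i))"
      using F_in by (auto simp: Fs_def)
    interpret residues_prime "p i" "residue_ring (int (p i))"
      using prime_p by (simp add: residues_prime_def)
    show ?thesis
      using field_axioms by (simp add: F residue_ring_simps)
  qed
  moreover have "\<not> Fs ! i \<simeq> Fs ! j" if "i < length Fs" "j < length Fs" "i \<noteq> j" for i j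
  proof
    assume "Fs ! i \<simeq> Fs ! j"
    \<comment> \<open>Isomorphic rings have equally many elements, and the \<open>i\<close>-th
      factor has \<open>p i\<close> of them.\<close>
    then have "p i = p j"
      using that ring_iso_same_card by (fastforce simp: length_Fs nth_Fs residue_ring_simps)
    with that p_inj show False
      by simp
  qed
  moreover have "Fs \<noteq> []"
    by (simp add: Fs_def n_def)
  ultimately show ?thesis
    unfolding R_def by blast
qed

end
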